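(* Let $K$ be a field, $x=(x_1,\dots,x_r)$, $y=(y_1,\dots,y_s)$ disjoint sets of variables, and let $f\in K[[x]]$ and $g\in K[[y]]$ be nonzero. (1) If $X$ is a matrix factorization of $f$ and $Y$ is a matrix factorization of $g$, then the multiplicative tensor product $X\widetilde{\otimes}Y$ is a matrix factorization of the product $fg\in K[[x_1,\dots,x_r,y_1,\dots,y_s]]$. Moreover, $\widetilde{\otimes}$ has a functorial variant $\widetilde{\otimes}'$ having the same effect on $X$ and $Y$, i.e. $X\widetilde{\otimes}'Y$ is also a matrix factorization of $fg$. (2) The multiplicative tensor product $(-)\widetilde{\otimes}(-): MF(K[[x]],f)\times MF(K[[y]],g)\to MF(K[[x,y]],fg)$ is a bifunctor. Moreover, its variant $(-)\widetilde{\otimes}'(-): MF(K[[x]],f)\times MF(K[[y]],g)\to MF(K[[x,y]],fg)$ is also a bifunctor.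
   Context: For a power series ring $R$ over $K$ and $f\in R$, an $n\times n$ matrix factorization of $f$ (of size $n$) is a pair $(\phi,\psi)$ of $n\times n$ matrices over $R$ with $\phi\psi=\psi\phi=fI_n$. The category $MF(R,f)$ has as objects the matrix factorizations of $f$ (of all sizes); a morphism $(\phi_1,\psi_1)\to(\phi_2,\psi_2)$ between factorizations of sizes $n_1,n_2$ is a pair $(\alpha,\beta)$ of $n_2\times n_1$ matrices over $R$ with $\alpha\phi_1=\phi_2\beta$ and $\psi_2\alpha=\beta\psi_1$. Composition and identities are componentwise: $(\alpha',\beta')\circ(\alpha,\beta)=(\alpha'\alpha,\beta'\beta)$, $\mathrm{id}=(I_n,I_n)$. $A\otimes B$ denotes the Kronecker product (replace each entry $a_{ij}$ of $A$ by the block $a_{ij}B$). For $X=(\phi,\psi)\in MF(K[[x]],f)$ and $Y=(\phi',\psi')\in MF(K[[y]],g)$, all matrices being regarded over $K[[x,y]]$: $$X\widetilde{\otimes}Y=\left(\begin{bmatrix}\phi\otimes\phi'&0\\0&\phi\otimes\phi'\end{bmatrix},\begin{bmatrix}\psi\otimes\psi'&0\\0&\psi\otimes\psi'\end{bmatrix}\right),\qquad X\widetilde{\otimes}'Y=\left(\begin{bmatrix}0&\phi\otimes\phi'\\\phi\otimes\phi'&0\end{bmatrix},\begin{bmatrix}0&\psi\otimes\psi'\\\psi\otimes\psi'&0\end{bmatrix}\right).$$ On morphisms $\zeta_f=(\alpha_f,\beta_f)$ of $MF(K[[x]],f)$ and $\zeta_g=(\alpha_g,\beta_g)$ of $MF(K[[y]],g)$,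 both $\zeta_f\widetilde{\otimes}\zeta_g$ and $\zeta_f\widetilde{\otimes}'\zeta_g$ are defined to be $$\left(\begin{bmatrix}\alpha_f\otimes\alpha_g&0\\0&\alpha_f\otimes\alpha_g\end{bmatrix},\begin{bmatrix}\beta_f\otimes\beta_g&0\\0&\beta_f\otimes\beta_g\end{bmatrix}\right).$$ *)

theory Defs
  imports "HOL-Library.Function_Algebras" "Jordan_Normal_Form.Matrix"
begin

section \<open>Formal power series in finitely many variables\<close>

text \<open>
  The variables are the elements of a finite type \<open>'v\<close>, a monomial is its exponent function of
  type \<open>'v \<Rightarrow> nat\<close> (added pointwise), and a power series is an arbitrary family of coefficients
  indexed by the monomials.
\<close>

typedef (overloaded) ('v, 'a) mps = "UNIV :: (('v \<Rightarrow> nat) \<Rightarrow> 'a) set"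
  morphisms mps_nth Abs_mps ..

setup_lifting type_definition_mps

lemma mps_eqI: "(\<And>m. mps_nth f m = mps_nth g m) \<Longrightarrow> f = g"
  by transfer auto

lemma finite_monomial_splits: "finite {(a, b). a + b = (m :: 'v::finite \<Rightarrow> nat)}"
proof -
  have fin: "finite {a. \<forall>i. a i \<le> m i}"
  proof -
    have "{a. \<forall>i. a i \<le> m i} = PiE UNIV (\<lambda>i. {..m i})"
      by (auto simp: PiE_def Pi_def)
    thus ?thesis by (simp add: finite_PiE)
  qed
  have "{(a, b). a + b = m} \<subseteq> {a. \<forall>i. a i \<le> m i} \<times> {a. \<forall>i. a i \<le> m i}"
    by (auto simp: plus_fun_def)
  thus ?thesis using fin finite_subset by blast
qed

instantiation mps :: (finite, comm_ring_1) comm_ring_1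
begin

lift_definition zero_mps :: "('a, 'b) mps" is "\<lambda>m. 0" .

lift_definition one_mps :: "('a, 'b) mps" is "\<lambda>m. if m = 0 then 1 else 0" .

lift_definition plus_mps :: "('a, 'b) mps \<Rightarrow> ('a, 'b) mps \<Rightarrow> ('a, 'b) mps" is
  "\<lambda>f g m. f m + g m" .

lift_definition minus_mps :: "('a, 'b) mps \<Rightarrow> ('a, 'b) mps \<Rightarrow> ('a, 'b) mps" is
  "\<lambda>f g m. f m - g m" .

lift_definition uminus_mps :: "('a, 'b) mps \<Rightarrow> ('a, 'b) mps" is "\<lambda>f m. - f m" .

lift_definition times_mps :: "('a, 'b) mps \<Rightarrow> ('a, 'b) mps \<Rightarrow> ('a, 'b) mps" is
  "\<lambda>f g m. \<Sum>(a, b) | a + b = m. f a * g b" .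

instance
proof
  fix f g h :: "('a, 'b) mps"
  show "f * g * h = f * (g * h)"
  proof (rule mps_eqI)
    fix m
    have "mps_nth (f * g * h) m =
        (\<Sum>p | fst p + snd p = m. \<Sum>q | fst q + snd q = fst p.
          mps_nth f (fst q) * mps_nth g (snd q) * mps_nth h (snd p))"
      by (simp add: times_mps.rep_eq sum_distrib_right case_prod_unfold)
    also have "\<dots> = (\<Sum>(p, q) \<in> (SIGMA p : {p. fst p + snd p = m}. {q. fst q + snd q = fst p}).
          mps_nth f (fst q) * mps_nth g (snd q) * mps_nth h (snd p))"
      using finite_monomial_splits
      by (subst sum.Sigma) (auto simp: case_prod_unfold)
    also have "\<dots> = (\<Sum>(p, q) \<in> (SIGMA p : {p. fst p + snd p = m}. {q. fst q + snd q = snd p}).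
          mps_nth f (fst p) * (mps_nth g (fst q) * mps_nth h (snd q)))"
      by (rule sum.reindex_bij_witness
            [where i = "\<lambda>(p, q). ((fst p + fst q, snd q), (fst p, fst q))"
               and j = "\<lambda>(p, q). ((fst q, snd q + snd p), (snd q, snd p))"])
         (auto simp: add.assoc mult.assoc)
    also have "\<dots> = (\<Sum>p | fst p + snd p = m. \<Sum>q | fst q + snd q = snd p.
          mps_nth f (fst p) * (mps_nth g (fst q) * mps_nth h (snd q)))"
      using finite_monomial_splits
      by (subst sum.Sigma) (auto simp: case_prod_unfold)
    also have "\<dots> = mps_nth (f * (g * h)) m"
      by (simp add: times_mps.rep_eq sum_distrib_left case_prod_unfold)
    finally show "mps_nth (f * g * h) m = mps_nth (f * (g * h)) m" .
  qed
  show "f * g = g * f"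
  proof (rule mps_eqI)
    fix m
    show "mps_nth (f * g) m = mps_nth (g * f) m"
      unfolding times_mps.rep_eq
      by (rule sum.reindex_bij_witness[where i = prod.swap and j = prod.swap])
         (auto simp: add.commute mult.commute)
  qed
  show "1 * f = f"
  proof (rule mps_eqI)
    fix m
    have "mps_nth (1 * f) m = (\<Sum>(a, b) \<in> {(0 :: 'a \<Rightarrow> nat, m)}. (if a = 0 then 1 else 0) * mps_nth f b)"
      unfolding times_mps.rep_eq one_mps.rep_eq
      by (rule sum.mono_neutral_right) (auto intro: finite_monomial_splits split: if_splits)
    thus "mps_nth (1 * f) m = mps_nth f m" by simp
  qed
  show "(f + g) * h = f * h + g * h"
    by (rule mps_eqI)
       (simp add: times_mps.rep_eq plus_mps.rep_eq case_prod_unfold distrib_right sum.distrib)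
  show "f + g + h = f + (g + h)" "f + g = g + f" "0 + f = f" "- f + f = 0" "f - g = f + - g"
    by (transfer; simp add: add.assoc add.commute fun_eq_iff)+
  show "(0 :: ('a, 'b) mps) \<noteq> 1"
    by transfer (auto simp: fun_eq_iff)
qed

end

text \<open>
  Reading a power series in the variables \<open>'v\<close> as one in the variables \<open>'w\<close>, along an injection
  \<open>\<iota>\<close> of the variables: monomials that involve a variable outside the range of \<open>\<iota>\<close> get the
  coefficient 0.
\<close>

definition mps_extend :: "('v \<Rightarrow> 'w) \<Rightarrow> ('v, 'a::zero) mps \<Rightarrow> ('w, 'a) mps" where
  "mps_extend \<iota> f =
     Abs_mps (\<lambda>m. if \<forall>w. w \<notin> range \<iota> \<longrightarrow> m w = 0 then mps_nth f (m \<circ> \<iota>) else 0)"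

text \<open>
  The disjoint union of two sets of variables is the sum type; these are the inclusions of
  \<open>K[[x]]\<close> and \<open>K[[y]]\<close> into \<open>K[[x,y]]\<close>.
\<close>

abbreviation mps_inl :: "('x, 'a::zero) mps \<Rightarrow> ('x + 'y, 'a) mps" where
  "mps_inl \<equiv> mps_extend Inl"

abbreviation mps_inr :: "('y, 'a::zero) mps \<Rightarrow> ('x + 'y, 'a) mps" where
  "mps_inr \<equiv> mps_extend Inr"


section \<open>Categories and bifunctors\<close>

text \<open>
  Hom-sets are indexed by source and target and need not be disjoint. Composition is written in
  the usual order, \<open>Comp v u\<close> being \<open>u\<close> followed by \<open>v\<close>.
\<close>

record ('o, 'm) cat =
  Obj :: "'o set"
  Hom :: "'o \<Rightarrow> 'o \<Rightarrow> 'm set"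
  Comp :: "'m \<Rightarrow> 'm \<Rightarrow> 'm"
  Ident :: "'o \<Rightarrow> 'm"

definition is_category :: "('o, 'm) cat \<Rightarrow> bool" where
  "is_category C \<longleftrightarrow>
     (\<forall>A\<in>Obj C. Ident C A \<in> Hom C A A) \<and>
     (\<forall>A\<in>Obj C. \<forall>B\<in>Obj C. \<forall>D\<in>Obj C. \<forall>u\<in>Hom C A B. \<forall>v\<in>Hom C B D. Comp C v u \<in> Hom C A D) \<and>
     (\<forall>A\<in>Obj C. \<forall>B\<in>Obj C. \<forall>u\<in>Hom C A B. Comp C u (Ident C A) = u \<and> Comp C (Ident C B) u = u) \<and>
     (\<forall>A\<in>Obj C. \<forall>B\<in>Obj C. \<forall>D\<in>Obj C. \<forall>E\<in>Obj C.
        \<forall>u\<in>Hom C A B. \<forall>v\<in>Hom C B D. \<forall>w\<in>Hom C D E.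
          Comp C w (Comp C v u) = Comp C (Comp C w v) u)"

definition is_functor ::
  "('o, 'm) cat \<Rightarrow> ('p, 'n) cat \<Rightarrow> ('o \<Rightarrow> 'p) \<Rightarrow> ('m \<Rightarrow> 'n) \<Rightarrow> bool" where
  "is_functor C D Fo Fm \<longleftrightarrow>
     is_category C \<and> is_category D \<and>
     (\<forall>A\<in>Obj C. Fo A \<in> Obj D) \<and>
     (\<forall>A\<in>Obj C. \<forall>B\<in>Obj C. \<forall>u\<in>Hom C A B. Fm u \<in> Hom D (Fo A) (Fo B)) \<and>
     (\<forall>A\<in>Obj C. Fm (Ident C A) = Ident D (Fo A)) \<and>
     (\<forall>A\<in>Obj C. \<forall>B\<in>Obj C. \<forall>E\<in>Obj C. \<forall>u\<in>Hom C A B. \<forall>v\<in>Hom C B E.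
        Fm (Comp C v u) = Comp D (Fm v) (Fm u))"

definition prod_cat :: "('o, 'm) cat \<Rightarrow> ('p, 'n) cat \<Rightarrow> ('o \<times> 'p, 'm \<times> 'n) cat" where
  "prod_cat C D = \<lparr>
     Obj = Obj C \<times> Obj D,
     Hom = (\<lambda>(A, B) (A', B'). Hom C A A' \<times> Hom D B B'),
     Comp = (\<lambda>(v, v') (u, u'). (Comp C v u, Comp D v' u')),
     Ident = (\<lambda>(A, B). (Ident C A, Ident D B)) \<rparr>"

definition is_bifunctor ::
  "('o, 'm) cat \<Rightarrow> ('p, 'n) cat \<Rightarrow> ('q, 'l) cat \<Rightarrow>
   ('o \<Rightarrow> 'p \<Rightarrow> 'q) \<Rightarrow> ('m \<Rightarrow> 'n \<Rightarrow> 'l) \<Rightarrow> bool" where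
  "is_bifunctor C D E Fo Fm \<longleftrightarrow>
     is_functor (prod_cat C D) E (\<lambda>(A, B). Fo A B) (\<lambda>(u, v). Fm u v)"


section \<open>Matrix factorizations\<close>

type_synonym 'a mat_pair = "'a mat \<times> 'a mat"

definition matrix_factorization :: "nat \<Rightarrow> 'a::comm_ring_1 \<Rightarrow> 'a mat_pair \<Rightarrow> bool" where
  "matrix_factorization n f = (\<lambda>(\<phi>, \<psi>).
     \<phi> \<in> carrier_mat n n \<and> \<psi> \<in> carrier_mat n n \<and>
     \<phi> * \<psi> = f \<cdot>\<^sub>m 1\<^sub>m n \<and> \<psi> * \<phi> = f \<cdot>\<^sub>m 1\<^sub>m n)"

text \<open>The empty factorization (\<open>n = 0\<close>) is allowed; it is a zero object of the category.\<close>

definition MF :: "'a::comm_ring_1 \<Rightarrow> ('a mat_pair, 'a mat_pair) cat" where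
  "MF f = \<lparr>
     Obj = {X. \<exists>n. matrix_factorization n f X},
     Hom = (\<lambda>(\<phi>\<^sub>1, \<psi>\<^sub>1) (\<phi>\<^sub>2, \<psi>\<^sub>2). {(\<alpha>, \<beta>).
        \<alpha> \<in> carrier_mat (dim_row \<phi>\<^sub>2) (dim_row \<phi>\<^sub>1) \<and>
        \<beta> \<in> carrier_mat (dim_row \<phi>\<^sub>2) (dim_row \<phi>\<^sub>1) \<and>
        \<alpha> * \<phi>\<^sub>1 = \<phi>\<^sub>2 * \<beta> \<and> \<psi>\<^sub>2 * \<alpha> = \<beta> * \<psi>\<^sub>1}),
     Comp = (\<lambda>(\<alpha>', \<beta>') (\<alpha>, \<beta>). (\<alpha>' * \<alpha>, \<beta>' * \<beta>)),
     Ident = (\<lambda>(\<phi>, \<psi>). (1\<^sub>m (dim_row \<phi>), 1\<^sub>m (dim_row \<phi>))) \<rparr>"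


section \<open>Multiplicative tensor products\<close>

definition kronecker :: "'a::times mat \<Rightarrow> 'a mat \<Rightarrow> 'a mat" where
  "kronecker A B = mat (dim_row A * dim_row B) (dim_col A * dim_col B)
     (\<lambda>(i, j). A $$ (i div dim_row B, j div dim_col B) * B $$ (i mod dim_row B, j mod dim_col B))"

definition diag2 :: "'a::zero mat \<Rightarrow> 'a mat" where
  "diag2 A = four_block_mat A (0\<^sub>m (dim_row A) (dim_col A)) (0\<^sub>m (dim_row A) (dim_col A)) A"

definition antidiag2 :: "'a::zero mat \<Rightarrow> 'a mat" where
  "antidiag2 A = four_block_mat (0\<^sub>m (dim_row A) (dim_col A)) A A (0\<^sub>m (dim_row A) (dim_col A))"

definition kronecker_xy ::
  "('x::finite, 'a::comm_ring_1) mps mat \<Rightarrow> ('y::finite, 'a) mps mat \<Rightarrow> ('x + 'y, 'a) mps mat" where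
  "kronecker_xy A B = kronecker (map_mat mps_inl A) (map_mat mps_inr B)"

definition mtensor ::
  "('x::finite, 'a::comm_ring_1) mps mat_pair \<Rightarrow> ('y::finite, 'a) mps mat_pair \<Rightarrow>
   ('x + 'y, 'a) mps mat_pair" where
  "mtensor = (\<lambda>(\<phi>, \<psi>) (\<phi>', \<psi>').
     (diag2 (kronecker_xy \<phi> \<phi>'), diag2 (kronecker_xy \<psi> \<psi>')))"

definition mtensor' ::
  "('x::finite, 'a::comm_ring_1) mps mat_pair \<Rightarrow> ('y::finite, 'a) mps mat_pair \<Rightarrow>
   ('x + 'y, 'a) mps mat_pair" where
  "mtensor' = (\<lambda>(\<phi>, \<psi>) (\<phi>', \<psi>').
     (antidiag2 (kronecker_xy \<phi> \<phi>'), antidiag2 (kronecker_xy \<psi> \<psi>')))"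

text \<open>The action on morphisms, shared by both tensor products.\<close>

definition mtensor_hom ::
  "('x::finite, 'a::comm_ring_1) mps mat_pair \<Rightarrow> ('y::finite, 'a) mps mat_pair \<Rightarrow>
   ('x + 'y, 'a) mps mat_pair" where
  "mtensor_hom = (\<lambda>(\<alpha>\<^sub>f, \<beta>\<^sub>f) (\<alpha>\<^sub>g, \<beta>\<^sub>g).
     (diag2 (kronecker_xy \<alpha>\<^sub>f \<alpha>\<^sub>g), diag2 (kronecker_xy \<beta>\<^sub>f \<beta>\<^sub>g)))"

end

theory Submission
  imports Defs
begin

text \<open>
  Everything rests on three multiplicativity laws. Extending the set of variables is a ring
  homomorphism, hence commutes with matrix multiplication; the Kronecker product satisfies the
  mixed-product rule \<open>(A \<otimes> B) (C \<otimes> D) = A C \<otimes> B D\<close>, which needs the entries of \<open>B\<close> and \<open>C\<close> to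
  commute; and the two ways of doubling a matrix, diagonal and antidiagonal, multiply like the
  elements \<open>1\<close> and \<open>-1\<close> of the group with two elements, being the Kronecker products of the
  identity matrix and of the swap matrix of size 2 with the given matrix.

  For objects, \<open>\<phi> \<psi> = f I\<close> and \<open>\<phi>' \<psi>' = g I\<close> give \<open>(\<phi> \<otimes> \<phi>') (\<psi> \<otimes> \<psi>') = f g I\<close>, and doubling both
  factors in the same way, diagonally or antidiagonally, yields the diagonal double of \<open>f g I\<close>,
  which is again \<open>f g I\<close>. For morphisms, the two defining equations are tensored and then doubled;
  since the diagonal doubling is neutral, morphisms doubled diagonally are compatible with
  factorizations doubled in either way. This is why one action on morphisms serves both tensor
  products, and why functoriality is the same statement for both of them. The locale
  \<open>matrix_doubling\<close> collects the rules for doublings from which both cases follow.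
\<close>

section \<open>Extending the set of variables\<close>

lemma mps_nth_extend:
  "mps_nth (mps_extend \<iota> f) m =
     (if \<forall>w. w \<notin> range \<iota> \<longrightarrow> m w = 0 then mps_nth f (m \<circ> \<iota>) else 0)"
  by (simp add: mps_extend_def Abs_mps_inverse)

text \<open>
  A splitting \<open>a + b = m\<close> of a monomial only involves variables of \<open>m\<close>. So if \<open>m\<close> lives on the range
  of \<open>\<iota>\<close>, its splittings are those of its restriction \<open>m \<circ> \<iota>\<close>, extended by zero; otherwise one of
  \<open>a\<close> and \<open>b\<close> involves a variable outside the range, and every term of the convolution vanishes.
\<close>

lemma mps_extend_mult:
  fixes f g :: "('v::finite, 'a::comm_ring_1) mps" and \<iota> :: "'v \<Rightarrow> 'w::finite"
  assumes "inj \<iota>"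
  shows "mps_extend \<iota> (f * g) = mps_extend \<iota> f * mps_extend \<iota> g"
proof (rule mps_eqI)
  fix m :: "'w \<Rightarrow> nat"
  show "mps_nth (mps_extend \<iota> (f * g)) m = mps_nth (mps_extend \<iota> f * mps_extend \<iota> g) m"
  proof (cases "\<forall>w. w \<notin> range \<iota> \<longrightarrow> m w = 0")
    case True
    \<comment> \<open>Extension by zero is inverse to restriction along \<open>\<iota>\<close> on monomials supported in its range.\<close>
    define ext where "ext = (\<lambda>a w. if w \<in> range \<iota> then a (inv_into UNIV \<iota> w) else (0::nat))"
    have ext_comp: "ext a \<circ> \<iota> = a" for a
      by (auto simp: ext_def fun_eq_iff inv_f_f[OF assms])
    have ext_restrict: "ext (a \<circ> \<iota>) = a" if "\<forall>w. w \<notin> range \<iota> \<longrightarrow> a w = 0" for a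
      using that by (auto simp: ext_def fun_eq_iff inv_f_f[OF assms])
    have supp: "(\<forall>w. w \<notin> range \<iota> \<longrightarrow> a w = 0) \<and> (\<forall>w. w \<notin> range \<iota> \<longrightarrow> b w = 0)"
      if "a + b = m" for a b
      using True that by (auto simp: plus_fun_def)
    have ext_add: "ext a + ext b = m" if "a + b = m \<circ> \<iota>" for a b
    proof -
      have "ext a + ext b = ext (a + b)" by (auto simp: ext_def fun_eq_iff)
      thus ?thesis using ext_restrict[OF True] that by simp
    qed
    have "(\<Sum>(a, b) | a + b = m \<circ> \<iota>. mps_nth f a * mps_nth g b) =
        (\<Sum>(a, b) | a + b = m. mps_nth (mps_extend \<iota> f) a * mps_nth (mps_extend \<iota> g) b)"
    proof (rule sum.reindex_bij_witness
        [where i = "\<lambda>(a, b). (a \<circ> \<iota>, b \<circ> \<iota>)" and j = "\<lambda>(a, b). (ext a, ext b)"])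
      fix p assume "p \<in> {(a, b). a + b = m \<circ> \<iota>}"
      then show "(case p of (a, b) \<Rightarrow> (ext a, ext b)) \<in> {(a, b). a + b = m}"
        and "(case (case p of (a, b) \<Rightarrow> (ext a, ext b)) of (a, b) \<Rightarrow> (a \<circ> \<iota>, b \<circ> \<iota>)) = p"
        and "(case (case p of (a, b) \<Rightarrow> (ext a, ext b)) of
              (a, b) \<Rightarrow> mps_nth (mps_extend \<iota> f) a * mps_nth (mps_extend \<iota> g) b)
            = (case p of (a, b) \<Rightarrow> mps_nth f a * mps_nth g b)"
        by (auto simp: ext_add ext_comp mps_nth_extend) (auto simp: ext_def)
    next
      fix p assume "p \<in> {(a, b). a + b = m}"
      then show "(case p of (a, b) \<Rightarrow> (a \<circ> \<iota>, b \<circ> \<iota>)) \<in> {(a, b). a + b = m \<circ> \<iota>}"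
        and "(case (case p of (a, b) \<Rightarrow> (a \<circ> \<iota>, b \<circ> \<iota>)) of (a, b) \<Rightarrow> (ext a, ext b)) = p"
        using supp ext_restrict by (auto simp: fun_eq_iff)
    qed
    thus ?thesis using True by (simp add: mps_nth_extend times_mps.rep_eq)
  next
    case False
    have "mps_nth (mps_extend \<iota> f) a * mps_nth (mps_extend \<iota> g) b = 0" if "a + b = m" for a b
      using False that by (auto simp: mps_nth_extend plus_fun_def)
    hence "mps_nth (mps_extend \<iota> f * mps_extend \<iota> g) m = 0"
      by (auto simp: times_mps.rep_eq intro!: sum.neutral)
    with False show ?thesis by (simp only: mps_nth_extend if_False)
  qed
qed

lemma mps_extend_one:
  "mps_extend \<iota> (1 :: ('v::finite, 'a::comm_ring_1) mps) = (1 :: ('w::finite, 'a) mps)"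
proof (rule mps_eqI)
  fix m :: "'w \<Rightarrow> nat"
  have "(\<forall>w. w \<notin> range \<iota> \<longrightarrow> m w = 0) \<and> m \<circ> \<iota> = 0 \<longleftrightarrow> m = 0"
  proof
    assume m: "(\<forall>w. w \<notin> range \<iota> \<longrightarrow> m w = 0) \<and> m \<circ> \<iota> = 0"
    show "m = 0"
    proof
      fix w
      show "m w = 0 w"
        using m by (cases "w \<in> range \<iota>") (auto dest: fun_cong)
    qed
  qed auto
  thus "mps_nth (mps_extend \<iota> (1 :: ('v, 'a) mps)) m = mps_nth 1 m"
    by (metis mps_nth_extend one_mps.rep_eq)
qed

lemma mps_extend_ring_hom:
  assumes "inj (\<iota> :: 'v::finite \<Rightarrow> 'w::finite)"
  shows "comm_ring_hom (mps_extend \<iota> :: ('v, 'a::comm_ring_1) mps \<Rightarrow> ('w, 'a) mps)"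
  by unfold_locales
     (auto intro!: mps_eqI
        simp: mps_extend_one mps_extend_mult[OF assms] mps_nth_extend plus_mps.rep_eq zero_mps.rep_eq)

interpretation mps_inl: comm_ring_hom
  "mps_inl :: ('x::finite, 'a::comm_ring_1) mps \<Rightarrow> ('x + 'y::finite, 'a) mps"
  by (rule mps_extend_ring_hom) simp

interpretation mps_inr: comm_ring_hom
  "mps_inr :: ('y::finite, 'a::comm_ring_1) mps \<Rightarrow> ('x::finite + 'y, 'a) mps"
  by (rule mps_extend_ring_hom) simp

section \<open>The Kronecker product\<close>

lemma kronecker_carrier:
  "A \<in> carrier_mat n m \<Longrightarrow> B \<in> carrier_mat p q \<Longrightarrow> kronecker A B \<in> carrier_mat (n * p) (m * q)"
  by (auto simp: kronecker_def)

lemma sum_div_mod: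
  "(\<Sum>l = 0..<n * q. h (l div q) (l mod q)) = (\<Sum>a = 0..<n. \<Sum>b = 0..<(q::nat). h a b)"
proof -
  have "(\<Sum>l = 0..<n * q. h (l div q) (l mod q)) = (\<Sum>(a, b) \<in> {0..<n} \<times> {0..<q}. h a b)"
  proof (rule sum.reindex_bij_witness
      [where i = "\<lambda>(a, b). a * q + b" and j = "\<lambda>l. (l div q, l mod q)"])
    fix p assume p: "p \<in> {0..<n} \<times> {0..<q}"
    obtain a b where ab: "p = (a, b)" "a < n" "b < q" using p by auto
    have "a * q + b < (a + 1) * q" using ab by simp
    also have "\<dots> \<le> n * q" using ab by (intro mult_le_mono1) simp
    finally show "(case p of (a, b) \<Rightarrow> a * q + b) \<in> {0..<n * q}" using ab by simp
    show "((case p of (a, b) \<Rightarrow> a * q + b) div q, (case p of (a, b) \<Rightarrow> a * q + b) mod q) = p"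
      using ab by simp
  next
    fix l assume l: "l \<in> {0..<n * q}"
    hence "q > 0" by (cases q) auto
    thus "(l div q, l mod q) \<in> {0..<n} \<times> {0..<q}"
      using l by (simp add: less_mult_imp_div_less)
  qed simp_all
  thus ?thesis by (simp add: sum.cartesian_product)
qed

text \<open>
  The summation index of the product on the left runs over pairs, encoded by quotient and
  remainder. Summing over the two components separately, the double sum is a product of two sums,
  one an entry of \<open>A C\<close> and the other an entry of \<open>B D\<close>.
\<close>

lemma kronecker_mixed_product:
  fixes A B C D :: "'a::comm_ring_1 mat"
  assumes A: "A \<in> carrier_mat n m" and C: "C \<in> carrier_mat m k"
    and B: "B \<in> carrier_mat p q" and D: "D \<in> carrier_mat q r"
  shows "kronecker A B * kronecker C D = kronecker (A * C) (B * D)"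
proof (rule eq_matI)
  fix i j assume "i < dim_row (kronecker (A * C) (B * D))" "j < dim_col (kronecker (A * C) (B * D))"
  hence i: "i < n * p" and j: "j < k * r"
    using A B C D by (auto simp: kronecker_def)
  have p: "p > 0" and r: "r > 0" using i j by (cases p; cases r; simp)+
  have ij: "i div p < n" "i mod p < p" "j div r < k" "j mod r < r"
    using i j p r by (auto simp: less_mult_imp_div_less)
  have "(kronecker A B * kronecker C D) $$ (i, j) =
      (\<Sum>l = 0..<m * q. A $$ (i div p, l div q) * B $$ (i mod p, l mod q) *
         (C $$ (l div q, j div r) * D $$ (l mod q, j mod r)))"
    using A B C D i j by (auto simp: kronecker_def scalar_prod_def)
  also have "\<dots> = (\<Sum>a = 0..<m. \<Sum>b = 0..<q. A $$ (i div p, a) * B $$ (i mod p, b) *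
         (C $$ (a, j div r) * D $$ (b, j mod r)))"
    by (rule sum_div_mod)
  also have "\<dots> = (\<Sum>a = 0..<m. A $$ (i div p, a) * C $$ (a, j div r)) *
      (\<Sum>b = 0..<q. B $$ (i mod p, b) * D $$ (b, j mod r))"
    by (simp add: sum_product ac_simps)
  also have "\<dots> = kronecker (A * C) (B * D) $$ (i, j)"
    using A B C D i j ij by (auto simp: kronecker_def scalar_prod_def)
  finally show "(kronecker A B * kronecker C D) $$ (i, j) = kronecker (A * C) (B * D) $$ (i, j)" .
qed (use A B C D in \<open>auto simp: kronecker_def\<close>)

lemma kronecker_scalar:
  fixes a b :: "'a::comm_ring_1"
  shows "kronecker (a \<cdot>\<^sub>m 1\<^sub>m n) (b \<cdot>\<^sub>m 1\<^sub>m m) = (a * b) \<cdot>\<^sub>m 1\<^sub>m (n * m)"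
proof (rule eq_matI)
  fix i j assume "i < dim_row ((a * b) \<cdot>\<^sub>m 1\<^sub>m (n * m))" "j < dim_col ((a * b) \<cdot>\<^sub>m 1\<^sub>m (n * m))"
  hence i: "i < n * m" and j: "j < n * m" by auto
  have m: "m > 0" using i by (cases m) auto
  have ij: "i div m < n" "i mod m < m" "j div m < n" "j mod m < m"
    using i j m by (auto simp: less_mult_imp_div_less)
  have "i = j \<longleftrightarrow> i div m = j div m \<and> i mod m = j mod m"
    by (metis div_mult_mod_eq)
  thus "kronecker (a \<cdot>\<^sub>m 1\<^sub>m n) (b \<cdot>\<^sub>m 1\<^sub>m m) $$ (i, j) = ((a * b) \<cdot>\<^sub>m 1\<^sub>m (n * m)) $$ (i, j)"
    using i j ij by (auto simp: kronecker_def)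
qed (auto simp: kronecker_def)

lemma kronecker_xy_carrier:
  "A \<in> carrier_mat n m \<Longrightarrow> B \<in> carrier_mat p q \<Longrightarrow> kronecker_xy A B \<in> carrier_mat (n * p) (m * q)"
  unfolding kronecker_xy_def by (rule kronecker_carrier) auto

lemma kronecker_xy_mult:
  assumes A: "A \<in> carrier_mat n m" and C: "C \<in> carrier_mat m k"
    and B: "B \<in> carrier_mat p q" and D: "D \<in> carrier_mat q r"
  shows "kronecker_xy A B * kronecker_xy C D = kronecker_xy (A * C) (B * D)"
  unfolding kronecker_xy_def mps_inl.mat_hom_mult[OF A C] mps_inr.mat_hom_mult[OF B D]
  by (rule kronecker_mixed_product) (use A B C D in auto)

lemma (in semiring_hom) mat_hom_scalar: "mat\<^sub>h (c \<cdot>\<^sub>m 1\<^sub>m n) = hom c \<cdot>\<^sub>m 1\<^sub>m n"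
  by (rule eq_matI) auto

lemma kronecker_xy_scalar:
  "kronecker_xy (f \<cdot>\<^sub>m 1\<^sub>m n) (g \<cdot>\<^sub>m 1\<^sub>m m) = (mps_inl f * mps_inr g) \<cdot>\<^sub>m 1\<^sub>m (n * m)"
  by (simp add: kronecker_xy_def mps_inl.mat_hom_scalar mps_inr.mat_hom_scalar kronecker_scalar)

lemma one_smult_one_mat: "(1 :: 'a::comm_ring_1) \<cdot>\<^sub>m 1\<^sub>m n = 1\<^sub>m n"
  by (rule eq_matI) auto

lemma kronecker_xy_one: "kronecker_xy (1\<^sub>m n) (1\<^sub>m m) = 1\<^sub>m (n * m)"
  using kronecker_xy_scalar[of 1 n 1 m] by (simp add: one_smult_one_mat)

section \<open>Doubling a matrix\<close>

lemma diag2_carrier: "A \<in> carrier_mat n m \<Longrightarrow> diag2 A \<in> carrier_mat (2 * n) (2 * m)"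
  by (auto simp: diag2_def)

lemma antidiag2_carrier: "A \<in> carrier_mat n m \<Longrightarrow> antidiag2 A \<in> carrier_mat (2 * n) (2 * m)"
  by (auto simp: antidiag2_def)

lemma doubling_mult:
  fixes A B :: "'a::comm_ring_1 mat"
  assumes A: "A \<in> carrier_mat n m" and B: "B \<in> carrier_mat m k"
  shows "diag2 A * diag2 B = diag2 (A * B)"
    and "diag2 A * antidiag2 B = antidiag2 (A * B)"
    and "antidiag2 A * diag2 B = antidiag2 (A * B)"
    and "antidiag2 A * antidiag2 B = diag2 (A * B)"
  using A B
  by (simp_all add: diag2_def antidiag2_def
       mult_four_block_mat[where ?nr1.0 = n and ?nr2.0 = n and ?n1.0 = m and ?n2.0 = m
         and ?nc1.0 = k and ?nc2.0 = k])

lemma diag2_scalar: "diag2 (c \<cdot>\<^sub>m 1\<^sub>m n) = (c :: 'a::comm_ring_1) \<cdot>\<^sub>m 1\<^sub>m (2 * n)"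
  by (rule eq_matI) (auto simp: diag2_def)

lemma diag2_one: "diag2 (1\<^sub>m n) = 1\<^sub>m (2 * n)"
  by (rule eq_matI) (auto simp: diag2_def)

text \<open>
  What the tensor product needs from a doubling \<open>T\<close>. The rule for two doubled factors makes a
  factorization of \<open>h\<close> into one of \<open>h\<close> again, since \<open>h I\<close> doubles diagonally to \<open>h I\<close>; the two mixed
  rules make diagonally doubled morphisms compatible with factorizations doubled by \<open>T\<close>.
\<close>

locale matrix_doubling =
  fixes T :: "'a::comm_ring_1 mat \<Rightarrow> 'a mat"
  assumes carrier: "A \<in> carrier_mat n m \<Longrightarrow> T A \<in> carrier_mat (2 * n) (2 * m)"
    and mult: "A \<in> carrier_mat n m \<Longrightarrow> B \<in> carrier_mat m k \<Longrightarrow> T A * T B = diag2 (A * B)"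
    and diag_mult: "A \<in> carrier_mat n m \<Longrightarrow> B \<in> carrier_mat m k \<Longrightarrow> diag2 A * T B = T (A * B)"
    and mult_diag: "A \<in> carrier_mat n m \<Longrightarrow> B \<in> carrier_mat m k \<Longrightarrow> T A * diag2 B = T (A * B)"

lemma matrix_doubling_diag2: "matrix_doubling diag2"
  by unfold_locales (auto simp: diag2_carrier doubling_mult)

lemma matrix_doubling_antidiag2: "matrix_doubling antidiag2"
  by unfold_locales (auto simp: antidiag2_carrier doubling_mult)

section \<open>Matrix factorizations form a category\<close>

lemma is_category_MF: "is_category (MF f)"
  unfolding is_category_def
proof (intro conjI ballI)
  fix A assume "A \<in> Obj (MF f)"
  thus "Ident (MF f) A \<in> Hom (MF f) A A"
    by (auto simp: MF_def matrix_factorization_def)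
next
  fix A B D u v
  assume "A \<in> Obj (MF f)" "B \<in> Obj (MF f)" "D \<in> Obj (MF f)"
    and "u \<in> Hom (MF f) A B" "v \<in> Hom (MF f) B D"
  then obtain n \<phi> \<psi> n' \<phi>' \<psi>' n'' \<phi>'' \<psi>'' \<alpha> \<beta> \<alpha>' \<beta>' where
    eqs: "A = (\<phi>, \<psi>)" "B = (\<phi>', \<psi>')" "D = (\<phi>'', \<psi>'')" "u = (\<alpha>, \<beta>)" "v = (\<alpha>', \<beta>')"
    and carr: "\<phi> \<in> carrier_mat n n" "\<psi> \<in> carrier_mat n n" "\<phi>' \<in> carrier_mat n' n'"
      "\<psi>' \<in> carrier_mat n' n'" "\<phi>'' \<in> carrier_mat n'' n''" "\<psi>'' \<in> carrier_mat n'' n''"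
      "\<alpha> \<in> carrier_mat n' n" "\<beta> \<in> carrier_mat n' n" "\<alpha>' \<in> carrier_mat n'' n'"
      "\<beta>' \<in> carrier_mat n'' n'"
    and comm: "\<alpha> * \<phi> = \<phi>' * \<beta>" "\<psi>' * \<alpha> = \<beta> * \<psi>" "\<alpha>' * \<phi>' = \<phi>'' * \<beta>'" "\<psi>'' * \<alpha>' = \<beta>' * \<psi>'"
    by (cases A; cases B; cases D; cases u; cases v)
       (auto simp: MF_def matrix_factorization_def)
  have "\<alpha>' * \<alpha> * \<phi> = \<alpha>' * (\<phi>' * \<beta>)"
    using carr comm by (simp add: assoc_mult_mat[of _ n'' n' _ n _ n])
  also have "\<dots> = \<alpha>' * \<phi>' * \<beta>"
    using carr by (simp add: assoc_mult_mat[of _ n'' n' _ n' _ n])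
  also have "\<dots> = \<phi>'' * (\<beta>' * \<beta>)"
    using carr comm by (simp add: assoc_mult_mat[of _ n'' n'' _ n' _ n])
  finally have 1: "\<alpha>' * \<alpha> * \<phi> = \<phi>'' * (\<beta>' * \<beta>)" .
  have "\<psi>'' * (\<alpha>' * \<alpha>) = \<psi>'' * \<alpha>' * \<alpha>"
    using carr by (simp add: assoc_mult_mat[of _ n'' n'' _ n' _ n])
  also have "\<dots> = \<beta>' * (\<psi>' * \<alpha>)"
    using carr comm by (simp add: assoc_mult_mat[of _ n'' n' _ n' _ n])
  also have "\<dots> = \<beta>' * \<beta> * \<psi>"
    using carr comm by (simp add: assoc_mult_mat[of _ n'' n' _ n _ n])
  finally have 2: "\<psi>'' * (\<alpha>' * \<alpha>) = \<beta>' * \<beta> * \<psi>" .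
  show "Comp (MF f) v u \<in> Hom (MF f) A D"
    using carr 1 2 by (auto simp: MF_def eqs)
next
  fix A B u
  assume "A \<in> Obj (MF f)" "B \<in> Obj (MF f)" "u \<in> Hom (MF f) A B"
  thus "Comp (MF f) u (Ident (MF f) A) = u" "Comp (MF f) (Ident (MF f) B) u = u"
    by (auto simp: MF_def matrix_factorization_def)
next
  fix A B D E u v w
  assume "u \<in> Hom (MF f) A B" "v \<in> Hom (MF f) B D" "w \<in> Hom (MF f) D E"
  then obtain a b d e u1 u2 v1 v2 w1 w2 where
    "u = (u1, u2)" "v = (v1, v2)" "w = (w1, w2)"
    and "u1 \<in> carrier_mat b a" "u2 \<in> carrier_mat b a" "v1 \<in> carrier_mat d b"
      "v2 \<in> carrier_mat d b" "w1 \<in> carrier_mat e d" "w2 \<in> carrier_mat e d"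
    by (cases A; cases B; cases D; cases E) (auto simp: MF_def)
  thus "Comp (MF f) w (Comp (MF f) v u) = Comp (MF f) (Comp (MF f) w v) u"
    by (simp add: MF_def assoc_mult_mat[of _ e d _ b _ a])
qed

lemma is_category_prod_cat:
  assumes C: "is_category C" and D: "is_category D"
  shows "is_category (prod_cat C D)"
  unfolding is_category_def
proof (intro conjI ballI)
  fix A assume "A \<in> Obj (prod_cat C D)"
  thus "Ident (prod_cat C D) A \<in> Hom (prod_cat C D) A A"
    using C D by (auto simp: is_category_def prod_cat_def)
next
  fix A B E u v
  assume "A \<in> Obj (prod_cat C D)" "B \<in> Obj (prod_cat C D)" "E \<in> Obj (prod_cat C D)"
    "u \<in> Hom (prod_cat C D) A B" "v \<in> Hom (prod_cat C D) B E"
  moreover have "Comp C v u \<in> Hom C A E"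
    if "A \<in> Obj C" "B \<in> Obj C" "E \<in> Obj C" "u \<in> Hom C A B" "v \<in> Hom C B E" for A B E u v
    using C that unfolding is_category_def by blast
  moreover have "Comp D v u \<in> Hom D A E"
    if "A \<in> Obj D" "B \<in> Obj D" "E \<in> Obj D" "u \<in> Hom D A B" "v \<in> Hom D B E" for A B E u v
    using D that unfolding is_category_def by blast
  ultimately show "Comp (prod_cat C D) v u \<in> Hom (prod_cat C D) A E"
    by (cases A; cases B; cases E; cases u; cases v) (clarsimp simp: prod_cat_def; blast)
next
  fix A B u
  assume "A \<in> Obj (prod_cat C D)" "B \<in> Obj (prod_cat C D)" "u \<in> Hom (prod_cat C D) A B"
  moreover have "Comp C u (Ident C A) = u \<and> Comp C (Ident C B) u = u"
    if "A \<in> Obj C" "B \<in> Obj C" "u \<in> Hom C A B" for A B u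
    using C that unfolding is_category_def by blast
  moreover have "Comp D u (Ident D A) = u \<and> Comp D (Ident D B) u = u"
    if "A \<in> Obj D" "B \<in> Obj D" "u \<in> Hom D A B" for A B u
    using D that unfolding is_category_def by blast
  ultimately show "Comp (prod_cat C D) u (Ident (prod_cat C D) A) = u"
    "Comp (prod_cat C D) (Ident (prod_cat C D) B) u = u"
    by (cases A; cases B; cases u; clarsimp simp: prod_cat_def; blast)+
next
  fix A B E F u v w
  assume "A \<in> Obj (prod_cat C D)" "B \<in> Obj (prod_cat C D)" "E \<in> Obj (prod_cat C D)"
    "F \<in> Obj (prod_cat C D)" "u \<in> Hom (prod_cat C D) A B" "v \<in> Hom (prod_cat C D) B E"
    "w \<in> Hom (prod_cat C D) E F"
  moreover have "Comp C w (Comp C v u) = Comp C (Comp C w v) u"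
    if "A \<in> Obj C" "B \<in> Obj C" "E \<in> Obj C" "F \<in> Obj C"
      "u \<in> Hom C A B" "v \<in> Hom C B E" "w \<in> Hom C E F" for A B E F u v w
    using C that unfolding is_category_def by blast
  moreover have "Comp D w (Comp D v u) = Comp D (Comp D w v) u"
    if "A \<in> Obj D" "B \<in> Obj D" "E \<in> Obj D" "F \<in> Obj D"
      "u \<in> Hom D A B" "v \<in> Hom D B E" "w \<in> Hom D E F" for A B E F u v w
    using D that unfolding is_category_def by blast
  ultimately show "Comp (prod_cat C D) w (Comp (prod_cat C D) v u) =
      Comp (prod_cat C D) (Comp (prod_cat C D) w v) u"
    by (cases A; cases B; cases E; cases F; cases u; cases v; cases w)
       (clarsimp simp: prod_cat_def; blast)
qed

section \<open>Tensor products of matrix factorizations\<close>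

definition doubled_tensor ::
  "(('x + 'y, 'a) mps mat \<Rightarrow> ('x + 'y, 'a) mps mat) \<Rightarrow>
   ('x::finite, 'a::comm_ring_1) mps mat_pair \<Rightarrow> ('y::finite, 'a) mps mat_pair \<Rightarrow>
   ('x + 'y, 'a) mps mat_pair" where
  "doubled_tensor T = (\<lambda>(\<phi>, \<psi>) (\<phi>', \<psi>'). (T (kronecker_xy \<phi> \<phi>'), T (kronecker_xy \<psi> \<psi>')))"

lemma mtensor_eq_doubled_tensor: "mtensor = doubled_tensor diag2"
  by (simp add: mtensor_def doubled_tensor_def)

lemma mtensor'_eq_doubled_tensor: "mtensor' = doubled_tensor antidiag2"
  by (simp add: mtensor'_def doubled_tensor_def)

text \<open>
  Composition of morphisms is componentwise matrix multiplication and does not refer to the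
  factored element, so the target may be the category of factorizations of any \<open>h\<close>.
\<close>

lemma mtensor_hom_Comp:
  fixes f :: "('x::finite, 'a::comm_ring_1) mps" and g :: "('y::finite, 'a) mps"
  assumes u: "u \<in> Hom (MF f) X\<^sub>1 X\<^sub>2" and v: "v \<in> Hom (MF f) X\<^sub>2 X\<^sub>3"
    and u': "u' \<in> Hom (MF g) Y\<^sub>1 Y\<^sub>2" and v': "v' \<in> Hom (MF g) Y\<^sub>2 Y\<^sub>3"
  shows "mtensor_hom (Comp (MF f) v u) (Comp (MF g) v' u') =
     Comp (MF h) (mtensor_hom v v') (mtensor_hom u u')"
proof -
  obtain a b c p q r \<alpha> \<beta> \<gamma> \<delta> \<alpha>' \<beta>' \<gamma>' \<delta>' where
    eqs: "u = (\<alpha>, \<beta>)" "v = (\<gamma>, \<delta>)" "u' = (\<alpha>', \<beta>')" "v' = (\<gamma>', \<delta>')"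
    and carr: "\<alpha> \<in> carrier_mat b a" "\<beta> \<in> carrier_mat b a"
      "\<gamma> \<in> carrier_mat c b" "\<delta> \<in> carrier_mat c b"
      "\<alpha>' \<in> carrier_mat q p" "\<beta>' \<in> carrier_mat q p"
      "\<gamma>' \<in> carrier_mat r q" "\<delta>' \<in> carrier_mat r q"
    using assms by (cases X\<^sub>1; cases X\<^sub>2; cases X\<^sub>3; cases Y\<^sub>1; cases Y\<^sub>2; cases Y\<^sub>3)
      (auto simp: MF_def)
  have "diag2 (kronecker_xy (B * A) (B' * A')) =
      diag2 (kronecker_xy B B') * diag2 (kronecker_xy A A')"
    if "A \<in> carrier_mat b a" "B \<in> carrier_mat c b" "A' \<in> carrier_mat q p" "B' \<in> carrier_mat r q"
    for A B :: "('x, 'a) mps mat" and A' B' :: "('y, 'a) mps mat"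
    using that
    by (simp add: kronecker_xy_mult doubling_mult(1)[OF kronecker_xy_carrier kronecker_xy_carrier])
  thus ?thesis using carr by (simp add: eqs mtensor_hom_def MF_def)
qed

text \<open>
  The mixed-product rule brings the factors of \<open>f\<close> together and those of \<open>g\<close> together, so the
  product before doubling is the Kronecker product of the scalar matrices of \<open>f\<close> and of \<open>g\<close>.
\<close>

lemma doubled_tensor_matrix_factorization:
  assumes T: "matrix_doubling T"
    and X: "matrix_factorization n f X" and Y: "matrix_factorization m g Y"
  shows "matrix_factorization (2 * n * m) (mps_inl f * mps_inr g) (doubled_tensor T X Y)"
proof -
  interpret matrix_doubling T by fact
  obtain \<phi> \<psi> \<phi>' \<psi>' where eqs: "X = (\<phi>, \<psi>)" "Y = (\<phi>', \<psi>')"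
    by (cases X; cases Y)
  have carr: "\<phi> \<in> carrier_mat n n" "\<psi> \<in> carrier_mat n n"
      "\<phi>' \<in> carrier_mat m m" "\<psi>' \<in> carrier_mat m m"
    and prods: "\<phi> * \<psi> = f \<cdot>\<^sub>m 1\<^sub>m n" "\<psi> * \<phi> = f \<cdot>\<^sub>m 1\<^sub>m n"
      "\<phi>' * \<psi>' = g \<cdot>\<^sub>m 1\<^sub>m m" "\<psi>' * \<phi>' = g \<cdot>\<^sub>m 1\<^sub>m m"
    using X Y by (auto simp: eqs matrix_factorization_def)
  have "T (kronecker_xy A A') * T (kronecker_xy B B') =
      (mps_inl f * mps_inr g) \<cdot>\<^sub>m 1\<^sub>m (2 * (n * m))"
    if "A \<in> carrier_mat n n" "B \<in> carrier_mat n n" "A' \<in> carrier_mat m m" "B' \<in> carrier_mat m m"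
      "A * B = f \<cdot>\<^sub>m 1\<^sub>m n" "A' * B' = g \<cdot>\<^sub>m 1\<^sub>m m" for A B A' B'
    using that
    by (simp add: mult[OF kronecker_xy_carrier kronecker_xy_carrier] kronecker_xy_mult
         kronecker_xy_scalar diag2_scalar)
  thus ?thesis
    using carr prods carrier[OF kronecker_xy_carrier, of _ n n _ m m]
    by (simp add: eqs doubled_tensor_def matrix_factorization_def mult.assoc)
qed

text \<open>
  Both equations for a morphism have the form \<open>A C = C' A'\<close>, up to exchanging the sides, with
  \<open>A\<close>, \<open>A'\<close> from the morphism and \<open>C\<close>, \<open>C'\<close> from the factorizations, so it suffices to tensor and
  double such squares.
\<close>

lemma mtensor_hom_Hom:
  assumes T: "matrix_doubling T"
    and X: "matrix_factorization n\<^sub>1 f X\<^sub>1" "matrix_factorization n\<^sub>2 f X\<^sub>2"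
    and Y: "matrix_factorization m\<^sub>1 g Y\<^sub>1" "matrix_factorization m\<^sub>2 g Y\<^sub>2"
    and u: "u \<in> Hom (MF f) X\<^sub>1 X\<^sub>2" and v: "v \<in> Hom (MF g) Y\<^sub>1 Y\<^sub>2"
  shows "mtensor_hom u v \<in> Hom (MF h) (doubled_tensor T X\<^sub>1 Y\<^sub>1) (doubled_tensor T X\<^sub>2 Y\<^sub>2)"
proof -
  interpret matrix_doubling T by fact
  obtain \<phi>\<^sub>1 \<psi>\<^sub>1 \<phi>\<^sub>2 \<psi>\<^sub>2 \<phi>\<^sub>1' \<psi>\<^sub>1' \<phi>\<^sub>2' \<psi>\<^sub>2' \<alpha> \<beta> \<alpha>' \<beta>' where
    eqs: "X\<^sub>1 = (\<phi>\<^sub>1, \<psi>\<^sub>1)" "X\<^sub>2 = (\<phi>\<^sub>2, \<psi>\<^sub>2)" "Y\<^sub>1 = (\<phi>\<^sub>1', \<psi>\<^sub>1')" "Y\<^sub>2 = (\<phi>\<^sub>2', \<psi>\<^sub>2')"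
      "u = (\<alpha>, \<beta>)" "v = (\<alpha>', \<beta>')"
    by (cases X\<^sub>1; cases X\<^sub>2; cases Y\<^sub>1; cases Y\<^sub>2; cases u; cases v)
  have carr: "\<phi>\<^sub>1 \<in> carrier_mat n\<^sub>1 n\<^sub>1" "\<psi>\<^sub>1 \<in> carrier_mat n\<^sub>1 n\<^sub>1"
      "\<phi>\<^sub>2 \<in> carrier_mat n\<^sub>2 n\<^sub>2" "\<psi>\<^sub>2 \<in> carrier_mat n\<^sub>2 n\<^sub>2"
      "\<phi>\<^sub>1' \<in> carrier_mat m\<^sub>1 m\<^sub>1" "\<psi>\<^sub>1' \<in> carrier_mat m\<^sub>1 m\<^sub>1"
      "\<phi>\<^sub>2' \<in> carrier_mat m\<^sub>2 m\<^sub>2" "\<psi>\<^sub>2' \<in> carrier_mat m\<^sub>2 m\<^sub>2"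
    using X Y by (auto simp: eqs matrix_factorization_def)
  have hom_carr: "\<alpha> \<in> carrier_mat n\<^sub>2 n\<^sub>1" "\<beta> \<in> carrier_mat n\<^sub>2 n\<^sub>1"
      "\<alpha>' \<in> carrier_mat m\<^sub>2 m\<^sub>1" "\<beta>' \<in> carrier_mat m\<^sub>2 m\<^sub>1"
    and comm: "\<alpha> * \<phi>\<^sub>1 = \<phi>\<^sub>2 * \<beta>" "\<psi>\<^sub>2 * \<alpha> = \<beta> * \<psi>\<^sub>1"
      "\<alpha>' * \<phi>\<^sub>1' = \<phi>\<^sub>2' * \<beta>'" "\<psi>\<^sub>2' * \<alpha>' = \<beta>' * \<psi>\<^sub>1'"
    using u v carr by (auto simp: eqs MF_def)
  have square: "diag2 (kronecker_xy A B) * T (kronecker_xy C D) =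
      T (kronecker_xy C' D') * diag2 (kronecker_xy A' B')"
    if "A \<in> carrier_mat n\<^sub>2 n\<^sub>1" "A' \<in> carrier_mat n\<^sub>2 n\<^sub>1"
      "B \<in> carrier_mat m\<^sub>2 m\<^sub>1" "B' \<in> carrier_mat m\<^sub>2 m\<^sub>1"
      "C \<in> carrier_mat n\<^sub>1 n\<^sub>1" "C' \<in> carrier_mat n\<^sub>2 n\<^sub>2"
      "D \<in> carrier_mat m\<^sub>1 m\<^sub>1" "D' \<in> carrier_mat m\<^sub>2 m\<^sub>2"
      and "A * C = C' * A'" "B * D = D' * B'" for A A' B B' C C' D D'
    using that
    by (simp add: diag_mult[OF kronecker_xy_carrier kronecker_xy_carrier]
         mult_diag[OF kronecker_xy_carrier kronecker_xy_carrier] kronecker_xy_mult)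
  have dims: "dim_row (T (kronecker_xy \<phi>\<^sub>1 \<phi>\<^sub>1')) = 2 * (n\<^sub>1 * m\<^sub>1)"
      "dim_row (T (kronecker_xy \<phi>\<^sub>2 \<phi>\<^sub>2')) = 2 * (n\<^sub>2 * m\<^sub>2)"
    using carrier[OF kronecker_xy_carrier[OF carr(1,5)]]
      carrier[OF kronecker_xy_carrier[OF carr(3,7)]] by auto
  have diag_carr: "diag2 (kronecker_xy \<alpha> \<alpha>') \<in> carrier_mat (2 * (n\<^sub>2 * m\<^sub>2)) (2 * (n\<^sub>1 * m\<^sub>1))"
      "diag2 (kronecker_xy \<beta> \<beta>') \<in> carrier_mat (2 * (n\<^sub>2 * m\<^sub>2)) (2 * (n\<^sub>1 * m\<^sub>1))"
    using hom_carr by (auto intro!: diag2_carrier kronecker_xy_carrier)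
  have "diag2 (kronecker_xy \<alpha> \<alpha>') * T (kronecker_xy \<phi>\<^sub>1 \<phi>\<^sub>1') =
      T (kronecker_xy \<phi>\<^sub>2 \<phi>\<^sub>2') * diag2 (kronecker_xy \<beta> \<beta>')"
    using carr hom_carr comm by (intro square)
  moreover have "T (kronecker_xy \<psi>\<^sub>2 \<psi>\<^sub>2') * diag2 (kronecker_xy \<alpha> \<alpha>') =
      diag2 (kronecker_xy \<beta> \<beta>') * T (kronecker_xy \<psi>\<^sub>1 \<psi>\<^sub>1')"
    using carr hom_carr comm by (intro square[symmetric]) auto
  ultimately show ?thesis
    using diag_carr by (simp add: eqs doubled_tensor_def mtensor_hom_def MF_def dims)
qed

lemma mtensor_hom_Ident:
  assumes T: "matrix_doubling T"
    and X: "matrix_factorization n f X" and Y: "matrix_factorization m g Y"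
  shows "mtensor_hom (Ident (MF f) X) (Ident (MF g) Y) = Ident (MF h) (doubled_tensor T X Y)"
proof -
  interpret matrix_doubling T by fact
  obtain \<phi> \<psi> \<phi>' \<psi>' where eqs: "X = (\<phi>, \<psi>)" "Y = (\<phi>', \<psi>')"
    by (cases X; cases Y)
  have carr: "\<phi> \<in> carrier_mat n n" "\<phi>' \<in> carrier_mat m m"
    using X Y by (auto simp: eqs matrix_factorization_def)
  have "dim_row (T (kronecker_xy \<phi> \<phi>')) = 2 * (n * m)"
    using carrier[OF kronecker_xy_carrier[OF carr]] by auto
  thus ?thesis
    using carr by (simp add: eqs doubled_tensor_def mtensor_hom_def MF_def kronecker_xy_one diag2_one)
qed

lemma is_bifunctor_doubled_tensor:
  assumes T: "matrix_doubling T"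
  shows "is_bifunctor (MF f) (MF g) (MF (mps_inl f * mps_inr g)) (doubled_tensor T) mtensor_hom"
  unfolding is_bifunctor_def is_functor_def
proof (intro conjI ballI is_category_prod_cat is_category_MF)
  let ?P = "prod_cat (MF f) (MF g)"
  let ?h = "mps_inl f * mps_inr g"
  let ?Fo = "\<lambda>(A, B). doubled_tensor T A B" and ?Fm = "\<lambda>(u, v). mtensor_hom u v"
  have Obj_P: "\<exists>X Y n m. A = (X, Y) \<and> matrix_factorization n f X \<and> matrix_factorization m g Y"
    if "A \<in> Obj ?P" for A
    using that by (auto simp: prod_cat_def MF_def)
  fix A assume A: "A \<in> Obj ?P"
  then obtain X\<^sub>1 Y\<^sub>1 n\<^sub>1 m\<^sub>1 where X1: "A = (X\<^sub>1, Y\<^sub>1)"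
    "matrix_factorization n\<^sub>1 f X\<^sub>1" "matrix_factorization m\<^sub>1 g Y\<^sub>1"
    using Obj_P by blast
  show "?Fo A \<in> Obj (MF ?h)"
    using doubled_tensor_matrix_factorization[OF T X1(2,3)] by (auto simp: X1(1) MF_def)
  show "?Fm (Ident ?P A) = Ident (MF ?h) (?Fo A)"
    using mtensor_hom_Ident[OF T X1(2,3)] by (simp add: X1(1) prod_cat_def)
  fix B assume B: "B \<in> Obj ?P"
  then obtain X\<^sub>2 Y\<^sub>2 n\<^sub>2 m\<^sub>2 where X2: "B = (X\<^sub>2, Y\<^sub>2)"
    "matrix_factorization n\<^sub>2 f X\<^sub>2" "matrix_factorization m\<^sub>2 g Y\<^sub>2"
    using Obj_P by blast
  fix u assume u: "u \<in> Hom ?P A B"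
  show "?Fm u \<in> Hom (MF ?h) (?Fo A) (?Fo B)"
    using u mtensor_hom_Hom[OF T X1(2) X2(2) X1(3) X2(3)] by (auto simp: X1(1) X2(1) prod_cat_def)
  fix E assume E: "E \<in> Obj ?P"
  fix v assume v: "v \<in> Hom ?P B E"
  show "?Fm (Comp ?P v u) = Comp (MF ?h) (?Fm v) (?Fm u)"
    using u v by (cases A; cases B; cases E) (auto simp: prod_cat_def intro: mtensor_hom_Comp)
qed

section \<open>The multiplicative tensor products are bifunctors\<close>

theorem theoremA:
  fixes f :: "('x::finite, 'k::field) mps"
    and g :: "('y::finite, 'k) mps"
  assumes "f \<noteq> 0" and "g \<noteq> 0"
  shows "(\<forall>n m X Y. matrix_factorization n f X \<and> matrix_factorization m g Y \<longrightarrow>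
            matrix_factorization (2 * n * m) (mps_inl f * mps_inr g) (mtensor X Y) \<and>
            matrix_factorization (2 * n * m) (mps_inl f * mps_inr g) (mtensor' X Y)) \<and>
         is_bifunctor (MF f) (MF g) (MF (mps_inl f * mps_inr g)) mtensor mtensor_hom \<and>
         is_bifunctor (MF f) (MF g) (MF (mps_inl f * mps_inr g)) mtensor' mtensor_hom"
  using doubled_tensor_matrix_factorization is_bifunctor_doubled_tensor
    matrix_doubling_diag2 matrix_doubling_antidiag2
  unfolding mtensor_eq_doubled_tensor mtensor'_eq_doubled_tensor
  by blast

end
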